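(* Let $m,n\ge 2$ be integers and let $p_1,\dots,p_m>0$ with $\sum_{i=1}^m p_i=1$ be the symbol probabilities of a Bernoulli source. Then there exist a constant $c>0$ (depending only on $n$ and $p_1,\dots,p_m$) and a sequence of decipherable word-based codes from the source alphabet $\{a_1,\dots,a_m\}$ to the output alphabet $\{b_1,\dots,b_n\}$ whose average delays $\bar N$ tend to infinity and whose redundancies $R$ satisfy $$R\le c\,\bar N^{-5/3}.$$
   Context: A Bernoulli source produces independent symbols from the input alphabet $\{a_1,\dots,a_m\}$ with probabilities $p_1,\dots,p_m$; its entropy is $H=-\sum_{i=1}^m p_i\log_2 p_i$. A message is an infinite sequence of input symbols. For a word $A=a_{i_1}\cdots a_{i_k}$, $|A|=k$ is its length and $p(A)=p_{i_1}\cdots p_{i_k}$. A word-based code consists of a finite set of distinct nonempty words $A_1,A_2,\dots$ over the input alphabet such that every message can be uniquely represented as an infinite concatenation of words $A_j$ (in particular, the set is prefix-free and every message begins with one of its words), together with a map $\phi$ assigning to each $A_j$ a word $\phi(A_j)$ over the output alphabet $\{b_1,\dots,b_n\}$. The code is decipherable if $\phi(A_{i_1})\cdots\phi(A_{i_s})=\phi(A_{j_1})\cdots\phi(A_{j_t})$ always implies $s=t$ and $i_k=j_k$ for $k=1,\dots,s$. Average delay: $\bar N=\sum_j p(A_j)|A_j|$. Redundancy: $R=\bar N^{-1}\sum_j p(A_j)|\phi(A_j)|-H/\log_2 n$. *)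

theory Defs
  imports Complex_Main "HOL-Library.Stream"
begin

text \<open>
  The symbols of an alphabet of size k are the numbers below k, so the input symbols are
  0, ..., m - 1 and the output symbols are 0, ..., n - 1. A message is a stream in
  \<^term>\<open>streams {..<m}\<close>.
\<close>

text \<open>\<^const>\<open>flat\<close> is the infinite concatenation only because all words of D are nonempty.\<close>

definition word_based_code ::
  "nat \<Rightarrow> nat \<Rightarrow> nat list set \<Rightarrow> (nat list \<Rightarrow> nat list) \<Rightarrow> bool" where
  "word_based_code m n D \<phi> \<longleftrightarrow>
     finite D \<and> D \<subseteq> lists {..<m} \<and> [] \<notin> D \<and>
     (\<forall>x \<in> streams {..<m}. \<exists>!ws. ws \<in> streams D \<and> flat ws = x) \<and>
     (\<forall>A \<in> D. \<phi> A \<in> lists {..<n})"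

definition decipherable :: "nat list set \<Rightarrow> (nat list \<Rightarrow> nat list) \<Rightarrow> bool" where
  "decipherable D \<phi> \<longleftrightarrow>
     (\<forall>us \<in> lists D. \<forall>vs \<in> lists D.
        concat (map \<phi> us) = concat (map \<phi> vs) \<longrightarrow> us = vs)"

definition entropy :: "nat \<Rightarrow> (nat \<Rightarrow> real) \<Rightarrow> real" where
  "entropy m p = - (\<Sum>i<m. p i * log 2 (p i))"

definition word_prob :: "(nat \<Rightarrow> real) \<Rightarrow> nat list \<Rightarrow> real" where
  "word_prob p A = prod_list (map p A)"

definition average_delay :: "(nat \<Rightarrow> real) \<Rightarrow> nat list set \<Rightarrow> real" where
  "average_delay p D = (\<Sum>A\<in>D. word_prob p A * real (length A))"

definition redundancy ::
  "nat \<Rightarrow> nat \<Rightarrow> (nat \<Rightarrow> real) \<Rightarrow> nat list set \<Rightarrow> (nat list \<Rightarrow> nat list) \<Rightarrow> real" where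
  "redundancy m n p D \<phi> =
     (\<Sum>A\<in>D. word_prob p A * real (length (\<phi> A))) / average_delay p D
       - entropy m p / log 2 (real n)"

end

theory Submission
  imports Defs "HOL-Library.Sublist"
begin

text \<open>
  Let S(w) be the base-n logarithm of 1/p(w). By Wald's identity the mean of S over a complete
  prefix-free dictionary is the mean delay times the entropy rate, so the redundancy is the mean
  excess of the code lengths over S, divided by the mean delay. Hence a dictionary on which S is
  almost always within 1/q of an integer is needed.

  Colour every word w by the cell of width 1/q containing the fractional part of S(w), together
  with the length of w modulo k. By Kac's return time lemma some word w returns to its colour after
  at most 2qk symbols on average; the dictionary consists of the extensions that make w return.
  The second component of the colour forces them to have length at least k, so the mean delay tends
  to infinity with k. Rounding S to nearest integers violates Kraft's inequality by a
  factor of at most n^(1/q), which is repaired by lengthening the code words of a subset of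
  probability about 2 ln n / q. The mean excess is thus O(1/q), and q = k^2 gives the exponent 5/3.
  No Diophantine approximation of the logarithms of the probabilities is involved.
\<close>

section \<open>Prefix-free dictionaries\<close>

definition prefix_free :: "'a list set \<Rightarrow> bool" where
  "prefix_free D \<longleftrightarrow> (\<forall>A\<in>D. \<forall>B\<in>D. prefix A B \<longrightarrow> A = B)"

lemma prefix_freeD:
  assumes "prefix_free D" "A \<in> D" "B \<in> D" "prefix A B \<or> prefix B A"
  shows "A = B"
  using assms unfolding prefix_free_def by metis

section \<open>Unique parsing of messages into dictionary words\<close>

lemma shift_eq_prefix_cases:
  assumes "A @- x = B @- y"
  shows "prefix A B \<or> prefix B A"
  using assms
proof (induction A arbitrary: B)
  case (Cons a A)
  then show ?case by (cases B) auto
qed simp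

text \<open>Greedy parsing: \<open>f\<close> selects the word with which the rest of the message
  begins. Corecursion yields a stream for every \<open>f\<close>; that its concatenation is the
  message again is the content of \<open>flat_parse\<close>.\<close>

primcorec parse :: "('a stream \<Rightarrow> 'a list) \<Rightarrow> 'a stream \<Rightarrow> 'a list stream" where
  "shd (parse f x) = f x"
| "stl (parse f x) = parse f (sdrop (length (f x)) x)"

text \<open>Strong induction on the position: the first word is nonempty, so dropping it strictly
  lowers the position of any letter beyond it.\<close>

lemma flat_parse:
  assumes f: "\<And>x. x \<in> S \<Longrightarrow> f x \<noteq> [] \<and> x = f x @- sdrop (length (f x)) x \<and> sdrop (length (f x)) x \<in> S"
    and "x \<in> S"
  shows "flat (parse f x) = x"
proof -
  have "flat (parse f x) !! i = x !! i" for i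
    using \<open>x \<in> S\<close>
  proof (induction i arbitrary: x rule: less_induct)
    case (less i)
    let ?y = "sdrop (length (f x)) x"
    have fx: "f x \<noteq> []" "x = f x @- ?y" "?y \<in> S" using f less.prems by auto
    have "flat (parse f x) = f x @- flat (parse f ?y)"
      using fx(1) by (subst flat_unfold) auto
    moreover have "\<not> i < length (f x) \<Longrightarrow> i - length (f x) < i" using fx(1) by (cases "f x") auto
    ultimately have "flat (parse f x) !! i = (f x @- ?y) !! i"
      using less.IH[OF _ fx(3)] by (simp add: shift_snth)
    then show ?case using fx(2) by simp
  qed
  then show ?thesis using smap_alt[of id "flat (parse f x)" x] by (simp add: stream.map_id)
qed

text \<open>By coinduction: two first words that begin the same stream are comparable as prefixes,
  hence equal, and cancelling them leaves the tails in the same situation.\<close>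

lemma flat_inject:
  assumes D: "prefix_free D" "[] \<notin> D"
    and "ws \<in> streams D" "ws' \<in> streams D" "flat ws = flat ws'"
  shows "ws = ws'"
  using assms(3-5)
proof (coinduction arbitrary: ws ws')
  case Eq_stream
  have shd: "shd ws \<in> D" "shd ws' \<in> D" and stl: "stl ws \<in> streams D" "stl ws' \<in> streams D"
    using Eq_stream by (auto elim: streamsE)
  then have "flat ws = shd ws @- flat (stl ws)" "flat ws' = shd ws' @- flat (stl ws')"
    using D(2) by (metis flat_unfold)+
  with Eq_stream have *: "shd ws @- flat (stl ws) = shd ws' @- flat (stl ws')" by simp
  have "shd ws = shd ws'"
    by (rule prefix_freeD[OF D(1) shd shift_eq_prefix_cases[OF *]])
  with * stl show ?case by auto
qed

lemma ex1_parse: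
  assumes D: "prefix_free D" "[] \<notin> D"
    and cover: "\<And>x. x \<in> streams X \<Longrightarrow> \<exists>A\<in>D. \<exists>y\<in>streams X. x = A @- y"
    and x: "x \<in> streams X"
  shows "\<exists>!ws. ws \<in> streams D \<and> flat ws = x"
proof -
  obtain f where f: "\<And>x. x \<in> streams X \<Longrightarrow> f x \<in> D \<and> (\<exists>y\<in>streams X. x = f x @- y)"
    using cover by metis
  have sd: "x = f x @- sdrop (length (f x)) x \<and> sdrop (length (f x)) x \<in> streams X"
    if x: "x \<in> streams X" for x
  proof -
    obtain y where "y \<in> streams X" "x = f x @- y" using f[OF x] by blast
    moreover from this have "sdrop (length (f x)) x = y"
      by (metis append_Nil diff_self_eq_0 drop_all le_refl sdrop.simps(1) sdrop_shift shift.simps(1))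
    ultimately show ?thesis by simp
  qed
  have "parse f x \<in> streams D"
    using x
  proof (coinduction arbitrary: x rule: streams.coinduct)
    case streams
    then show ?case
      using f[OF streams] sd[OF streams] by (metis parse.simps stream.collapse)
  qed
  moreover have "flat (parse f x) = x"
  proof (rule flat_parse[OF _ x])
    fix y assume y: "y \<in> streams X"
    then have "f y \<noteq> []" using f[OF y] D(2) by metis
    then show "f y \<noteq> [] \<and> y = f y @- sdrop (length (f y)) y \<and> sdrop (length (f y)) y \<in> streams X"
      using sd[OF y] by (rule conjI)
  qed
  ultimately show ?thesis using flat_inject[OF D] by metis
qed

section \<open>Decipherability and Kraft's inequality\<close>

text \<open>The first code words of two equal concatenations are comparable as prefixes, hence
  equal, and can be cancelled. Nonempty code words prevent one sequence from ending before the
  other.\<close>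

lemma decipherableI:
  assumes "inj_on \<phi> D" "prefix_free (\<phi> ` D)" "[] \<notin> \<phi> ` D"
  shows "decipherable D \<phi>"
proof -
  have "us = vs" if "us \<in> lists D" "vs \<in> lists D" "concat (map \<phi> us) = concat (map \<phi> vs)" for us vs
    using that
  proof (induction us arbitrary: vs)
    case Nil
    then show ?case using assms(3) by (cases vs) (auto simp: image_iff)
  next
    case (Cons u us)
    then have u: "u \<in> D" "us \<in> lists D" by auto
    with Cons.prems assms(3) obtain v vs' where vs: "vs = v # vs'"
      by (cases vs) (auto simp: image_iff)
    with Cons.prems have v: "v \<in> D" "vs' \<in> lists D"
      and eq: "\<phi> u @ concat (map \<phi> us) = \<phi> v @ concat (map \<phi> vs')" by auto
    have "prefix (\<phi> u) (\<phi> v) \<or> prefix (\<phi> v) (\<phi> u)"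
      by (metis eq prefixI prefix_same_cases)
    then have "\<phi> u = \<phi> v"
      by (rule prefix_freeD[OF assms(2) imageI[OF u(1)] imageI[OF v(1)]])
    have "u = v" by (rule inj_onD[OF assms(1) \<open>\<phi> u = \<phi> v\<close> u(1) v(1)])
    moreover have "us = vs'" using Cons.IH[OF v(2)] u(2) eq \<open>\<phi> u = \<phi> v\<close> by simp
    ultimately show ?case by (simp add: vs)
  qed
  then show ?thesis by (auto simp: decipherable_def)
qed

text \<open>Greedy choice in order of increasing length: when a code word of length L is due, every
  earlier \<open>B\<close> forbids at most n^(L - \<open>l B\<close>) of the n^L candidates. Since
  the Kraft sum including the new term is at most 1, a candidate remains.\<close>

lemma kraft_converse:
  fixes l :: "'a \<Rightarrow> nat" and n :: nat
  assumes "finite D" "n > 0" "(\<Sum>A\<in>D. 1 / real n ^ l A) \<le> 1"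
  shows "\<exists>\<phi>. \<phi> ` D \<subseteq> lists {..<n} \<and> (\<forall>A\<in>D. length (\<phi> A) = l A) \<and>
    inj_on \<phi> D \<and> prefix_free (\<phi> ` D)"
  using assms(1,3)
proof (induction D rule: finite_ranking_induct[where f = l])
  case empty
  then show ?case by (auto simp: prefix_free_def)
next
  case (insert A D)
  show ?case
  proof (cases "A \<in> D")
    case True
    with insert show ?thesis by (simp add: insert_absorb)
  next
    case False
    let ?L = "l A"
    have sum: "(\<Sum>B\<in>D. 1 / real n ^ l B) + 1 / real n ^ ?L \<le> 1"
      using insert False by simp
    then have "(\<Sum>B\<in>D. 1 / real n ^ l B) \<le> 1"
      by (smt (verit) divide_nonneg_nonneg of_nat_0_le_iff zero_le_power)
    then obtain \<phi> where \<phi>: "\<phi> ` D \<subseteq> lists {..<n}" "\<And>B. B \<in> D \<Longrightarrow> length (\<phi> B) = l B"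
      "inj_on \<phi> D" "prefix_free (\<phi> ` D)"
      using insert by auto
    define W where "W = {u \<in> lists {..<n}. length u = ?L}"
    define E where "E B = (\<lambda>v. \<phi> B @ v) ` {v \<in> lists {..<n}. length v = ?L - l B}" for B
    have cardW: "finite {u \<in> lists {..<n}. length u = k}" "card {u \<in> lists {..<n}. length u = k} = n ^ k" for k
      using finite_lists_length_eq[of "{..<n}" k] card_lists_length_eq[of "{..<n}" k]
      by (simp_all add: lists_eq_set conj_commute)
    have "real (card (\<Union>B\<in>D. E B)) \<le> (\<Sum>B\<in>D. real (card (E B)))"
      using card_UN_le[OF insert(1), of E] by (metis of_nat_le_iff of_nat_sum)
    also have "\<dots> \<le> (\<Sum>B\<in>D. real n ^ ?L / real n ^ l B)"
    proof (intro sum_mono)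
      fix B assume "B \<in> D"
      then have "l B \<le> ?L" using insert by auto
      have "card (E B) \<le> n ^ (?L - l B)"
        unfolding E_def by (rule order.trans[OF card_image_le]) (simp_all add: cardW)
      then have "real (card (E B)) \<le> real n ^ (?L - l B)"
        by (metis of_nat_le_iff of_nat_power)
      also have "\<dots> = real n ^ ?L / real n ^ l B"
        using \<open>l B \<le> ?L\<close> \<open>n > 0\<close> by (simp add: power_diff)
      finally show "real (card (E B)) \<le> real n ^ ?L / real n ^ l B" .
    qed
    also have "\<dots> = real n ^ ?L * (\<Sum>B\<in>D. 1 / real n ^ l B)"
      by (simp add: sum_distrib_left)
    also have "\<dots> \<le> real n ^ ?L * (1 - 1 / real n ^ ?L)"
      using sum by (intro mult_left_mono) auto
    also have "\<dots> < real (card W)"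
      using \<open>n > 0\<close> cardW(2)[of ?L] unfolding W_def by (simp add: algebra_simps)
    finally have "card (\<Union>B\<in>D. E B) < card W" by simp
    moreover have "finite (\<Union>B\<in>D. E B)" using insert(1) cardW(1) by (auto simp: E_def)
    ultimately obtain u where u: "u \<in> W" "u \<notin> (\<Union>B\<in>D. E B)"
      by (metis card_mono linorder_not_less subsetI)
    have no: "\<not> prefix (\<phi> B) u" if "B \<in> D" for B
    proof
      assume "prefix (\<phi> B) u"
      then obtain v where "u = \<phi> B @ v" by (auto simp: prefix_def)
      with u(1) \<phi>(2)[OF that] have "u \<in> E B" by (auto simp: E_def W_def)
      with u(2) that show False by auto
    qed
    \<comment> \<open>The order of the induction gives \<open>l B \<le> ?L\<close>, so the new code
      word could be a prefix of an older one only by being equal to it.\<close>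
    have no': "\<not> prefix u (\<phi> B)" if "B \<in> D" for B
    proof
      assume *: "prefix u (\<phi> B)"
      have "length (\<phi> B) \<le> length u" using \<phi>(2)[OF that] insert(2)[OF that] u(1) by (simp add: W_def)
      with * have "u = \<phi> B" by (metis append_eq_append_conv append_Nil2 prefix_def prefix_length_le order.antisym)
      with no[OF that] show False by simp
    qed
    have u': "u \<notin> \<phi> ` D" using no by auto
    let ?\<psi> = "\<phi>(A := u)"
    have img: "?\<psi> ` insert A D = insert u (\<phi> ` D)" and eq: "\<And>B. B \<in> D \<Longrightarrow> ?\<psi> B = \<phi> B"
      using False by auto
    have "prefix_free (insert u (\<phi> ` D))"
      using \<phi>(4) no no' by (auto simp: prefix_free_def)
    moreover have "inj_on ?\<psi> (insert A D)"
      using \<phi>(3) False u' by (auto simp: inj_on_def)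
    moreover have "?\<psi> ` insert A D \<subseteq> lists {..<n}"
      unfolding img using \<phi>(1) u(1) by (simp add: W_def)
    moreover have "\<forall>B\<in>insert A D. length (?\<psi> B) = l B"
      using \<phi>(2) u(1) False by (auto simp: W_def)
    ultimately show ?thesis by (intro exI[of _ ?\<psi>] conjI) (simp_all only: img)
  qed
qed

section \<open>Two facts about real numbers\<close>

text \<open>Lying in the same cell, the fractional parts differ by less than 1/q; the integer is the
  difference of the floors.\<close>

lemma near_integer:
  fixes x y q :: real
  assumes "\<lfloor>q * frac x\<rfloor> = \<lfloor>q * frac y\<rfloor>" "q > 0"
  shows "\<exists>r::int. \<bar>x - y - of_int r\<bar> < 1 / q"
proof -
  have "\<bar>q * frac x - q * frac y\<bar> < 1"
    using assms(1) by linarith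
  then have "q * \<bar>frac x - frac y\<bar> < 1"
    using assms(2) by (simp add: abs_mult flip: right_diff_distrib)
  then have "\<bar>frac x - frac y\<bar> < 1 / q"
    using assms(2) by (simp add: field_simps)
  moreover have "frac x - frac y = x - y - of_int (\<lfloor>x\<rfloor> - \<lfloor>y\<rfloor>)" by (simp add: frac_def)
  ultimately show ?thesis by metis
qed

text \<open>Adding elements one at a time, the sum first reaches \<open>T\<close> in a step of size
  at most \<open>\<eta>\<close>. This later selects the words whose code words are
  lengthened.\<close>

lemma exists_subset_sum_between:
  fixes f :: "'a \<Rightarrow> real"
  assumes "finite D" "\<And>A. A \<in> D \<Longrightarrow> f A \<le> \<eta>" "0 \<le> T" "T \<le> sum f D" "\<eta> \<ge> 0"
  shows "\<exists>B\<subseteq>D. T \<le> sum f B \<and> sum f B \<le> T + \<eta>"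
  using assms(1,2,4)
proof (induction D rule: finite_induct)
  case empty
  then show ?case using assms(3,5) by auto
next
  case (insert A D)
  show ?case
  proof (cases "T \<le> sum f D")
    case True
    then obtain B where "B \<subseteq> D" "T \<le> sum f B" "sum f B \<le> T + \<eta>"
      using insert by auto
    then show ?thesis by blast
  next
    case False
    have "sum f (insert A D) = f A + sum f D" "f A \<le> \<eta>" using insert by auto
    then show ?thesis using False insert.prems(2) by (intro exI[of _ "insert A D"]) auto
  qed
qed

section \<open>Stopping a Bernoulli source\<close>

text \<open>No nonempty prefix of the word satisfies \<open>P\<close>. The empty word is never
  tested, since a return takes at least one symbol. Shifting \<open>P\<close> along the letters
  matches the recursions of \<open>mean\<close> and \<open>leaves\<close>.\<close>

primrec avoids :: "('a list \<Rightarrow> bool) \<Rightarrow> 'a list \<Rightarrow> bool" where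
  "avoids P [] \<longleftrightarrow> True"
| "avoids P (a # u) \<longleftrightarrow> \<not> P [a] \<and> avoids (\<lambda>v. P (a # v)) u"

lemma avoids_prefix:
  assumes "avoids P u" "prefix v u" "v \<noteq> []"
  shows "\<not> P v"
  using assms
proof (induction u arbitrary: P v)
  case (Cons a u)
  then obtain v' where v: "v = a # v'" "prefix v' u" by (cases v) auto
  show ?case
  proof (cases "v' = []")
    case False
    then show ?thesis using Cons.IH[of "\<lambda>v. P (a # v)" v'] Cons.prems v by auto
  qed (use Cons.prems v in auto)
qed simp

locale bernoulli_source =
  fixes m :: nat and p :: "nat \<Rightarrow> real"
  assumes m_ge_2: "m \<ge> 2"
    and p_pos: "\<And>i. i < m \<Longrightarrow> p i > 0"
    and p_sum: "(\<Sum>i<m. p i) = 1"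
begin

section \<open>Expectations over words of fixed length\<close>

text \<open>The expectation of \<open>f\<close> at the first \<open>t\<close> symbols of the source,
  written as a finite recursion on the first symbol, so that no measure on messages is
  involved.\<close>

primrec mean :: "nat \<Rightarrow> (nat list \<Rightarrow> real) \<Rightarrow> real" where
  "mean 0 f = f []"
| "mean (Suc t) f = (\<Sum>a<m. p a * mean t (\<lambda>u. f (a # u)))"

lemma mean_mono:
  assumes "\<And>u. u \<in> lists {..<m} \<Longrightarrow> length u = t \<Longrightarrow> f u \<le> g u"
  shows "mean t f \<le> mean t g"
  using assms
proof (induction t arbitrary: f g)
  case (Suc t)
  show ?case
    unfolding mean.simps
    by (intro sum_mono mult_left_mono Suc.IH) (use Suc.prems p_pos in \<open>auto intro: less_imp_le\<close>)
qed simp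

lemma mean_cong:
  assumes "\<And>u. u \<in> lists {..<m} \<Longrightarrow> length u = t \<Longrightarrow> f u = g u"
  shows "mean t f = mean t g"
  using mean_mono[of t f g] mean_mono[of t g f] assms by fastforce

lemma mean_const: "mean t (\<lambda>_. c) = c"
  by (induction t) (simp_all add: p_sum flip: sum_distrib_right)

lemma mean_sum: "mean t (\<lambda>u. \<Sum>i\<in>I. f i u) = (\<Sum>i\<in>I. mean t (f i))"
proof (induction t arbitrary: f)
  case (Suc t)
  then show ?case
    using sum.swap[of "\<lambda>a i. p a * mean t (\<lambda>u. f i (a # u))" I "{..<m}"]
    by (simp add: sum_distrib_left)
qed simp

text \<open>Independence of the symbols: fixing the first \<open>t\<close> of them leaves the law of
  the next \<open>j\<close> unchanged.\<close>

lemma mean_append: "mean (t + j) f = mean t (\<lambda>w. mean j (\<lambda>u. f (w @ u)))"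
  by (induction t arbitrary: f) simp_all

lemma mean_greater:
  assumes "\<And>u. u \<in> lists {..<m} \<Longrightarrow> c < f u"
  shows "c < mean t f"
  using assms
proof (induction t arbitrary: f)
  case (Suc t)
  have "c = (\<Sum>a<m. p a * c)" by (simp add: p_sum flip: sum_distrib_right)
  also have "\<dots> < mean (Suc t) f"
    unfolding mean.simps
    by (intro sum_strict_mono mult_strict_left_mono Suc.IH)
      (use Suc.prems p_pos m_ge_2 in \<open>auto simp: lessThan_empty_iff\<close>)
  finally show ?case .
qed simp

text \<open>The words at which P first holds, cut off at length M.\<close>

primrec leaves :: "(nat list \<Rightarrow> bool) \<Rightarrow> nat \<Rightarrow> nat list set" where
  "leaves P 0 = {[]}"
| "leaves P (Suc M) =
    (\<Union>a<m. (#) a ` (if P [a] then {[]} else leaves (\<lambda>v. P (a # v)) M))"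

lemma word_prob_simps [simp]:
  "word_prob p [] = 1" "word_prob p (a # u) = p a * word_prob p u"
  by (simp_all add: word_prob_def)

lemma word_prob_pos: "u \<in> lists {..<m} \<Longrightarrow> word_prob p u > 0"
  by (induction u) (auto simp: p_pos)

lemma finite_leaves: "finite (leaves P M)"
  by (induction M arbitrary: P) auto

lemma leaves_SucE:
  assumes "A \<in> leaves P (Suc M)"
  obtains a u where "A = a # u" "a < m" "P [a]" "u = []"
  | a u where "A = a # u" "a < m" "\<not> P [a]" "u \<in> leaves (\<lambda>v. P (a # v)) M"
  using assms by (auto split: if_splits)

lemma leaves_lists: "leaves P M \<subseteq> lists {..<m}"
proof (induction M arbitrary: P)
  case (Suc M)
  show ?case
  proof
    fix A assume "A \<in> leaves P (Suc M)"
    then show "A \<in> lists {..<m}"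
      by (cases rule: leaves_SucE) (use Suc.IH in auto)
  qed
qed simp

lemma Nil_notin_leaves: "M > 0 \<Longrightarrow> [] \<notin> leaves P M"
  by (cases M) auto

lemma leaves_stop: "A \<in> leaves P M \<Longrightarrow> P A \<or> length A = M"
proof (induction M arbitrary: P A)
  case (Suc M)
  from Suc.prems show ?case
  proof (cases rule: leaves_SucE)
    case (2 a u)
    then show ?thesis using Suc.IH[OF 2(4)] by simp
  qed simp
qed simp

lemma prefix_free_leaves: "prefix_free (leaves P M)"
proof (induction M arbitrary: P)
  case (Suc M)
  have "A = B" if AB: "A \<in> leaves P (Suc M)" "B \<in> leaves P (Suc M)" "prefix A B" for A B
    using AB(1)
  proof (cases rule: leaves_SucE)
    case A: (1 a u)
    from AB(2) show ?thesis
      by (cases rule: leaves_SucE) (use A AB(3) in simp_all)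
  next
    case A: (2 a u)
    from AB(2) show ?thesis
    proof (cases rule: leaves_SucE)
      case (1 b v)
      then show ?thesis using A AB(3) by simp
    next
      case B: (2 b v)
      have "b = a" "prefix u v" using A(1) B(1) AB(3) by simp_all
      with B(4) have "u = v" using prefix_freeD[OF Suc A(4)] by simp
      with A(1) B(1) \<open>b = a\<close> show ?thesis by simp
    qed
  qed
  then show ?case unfolding prefix_free_def by blast
qed (simp add: prefix_free_def)

lemma leaves_cover:
  "x \<in> streams {..<m} \<Longrightarrow> \<exists>A\<in>leaves P M. \<exists>y\<in>streams {..<m}. x = A @- y"
proof (induction M arbitrary: P x)
  case (Suc M)
  obtain a x' where x: "x = a ## x'" "a < m" "x' \<in> streams {..<m}"
    using Suc.prems by (cases x) (auto simp: streams_Stream)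
  show ?case
  proof (cases "P [a]")
    case True
    then have "[a] \<in> leaves P (Suc M)" using x(2) by auto
    moreover have "x = [a] @- x'" using x(1) by simp
    ultimately show ?thesis using x(3) by blast
  next
    case False
    obtain A y where A: "A \<in> leaves (\<lambda>v. P (a # v)) M" "y \<in> streams {..<m}" "x' = A @- y"
      using Suc.IH[OF x(3)] by blast
    then have "a # A \<in> leaves P (Suc M)" using x(2) False by auto
    moreover have "x = (a # A) @- y" using x(1) A(3) by simp
    ultimately show ?thesis using A(2) by blast
  qed
qed auto

section \<open>Wald's identity and the mean delay of a stopped source\<close>

lemma sum_leaves_Suc:
  fixes g :: "nat list \<Rightarrow> real"
  shows "sum g (leaves P (Suc M)) =
    (\<Sum>a<m. if P [a] then g [a] else (\<Sum>u\<in>leaves (\<lambda>v. P (a # v)) M. g (a # u)))"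
proof -
  let ?S = "\<lambda>a. if P [a] then {[]} else leaves (\<lambda>v. P (a # v)) M"
  have "sum g (leaves P (Suc M)) = (\<Sum>a<m. sum g ((#) a ` ?S a))"
    unfolding leaves.simps
    by (rule sum.UNION_disjoint) (auto simp: finite_leaves)
  also have "\<dots> = (\<Sum>a<m. \<Sum>u\<in>?S a. g (a # u))"
    by (simp add: sum.reindex)
  also have "\<dots> = (\<Sum>a<m. if P [a] then g [a] else (\<Sum>u\<in>leaves (\<lambda>v. P (a # v)) M. g (a # u)))"
    by (rule sum.cong) auto
  finally show ?thesis .
qed

lemma sum_leaves_prob: "(\<Sum>A\<in>leaves P M. word_prob p A) = 1"
proof (induction M arbitrary: P)
  case (Suc M)
  show ?case
    unfolding sum_leaves_Suc word_prob_simps sum_distrib_left[symmetric] Suc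
    by (simp add: p_sum)
qed simp

text \<open>Splitting off the first symbol contributes the mean of \<open>s\<close> once, because
  each subtree has total probability 1; what remains is the same sum over the subtrees. The mean
  delay obeys the same recursion with \<open>s\<close> = 1, so the factor passes through the
  induction.\<close>

lemma wald_identity:
  "(\<Sum>A\<in>leaves P M. word_prob p A * (\<Sum>a\<leftarrow>A. s a)) =
    (\<Sum>a<m. p a * s a) * average_delay p (leaves P M)"
proof (induction M arbitrary: P)
  case 0
  then show ?case by (simp add: average_delay_def)
next
  case (Suc M)
  let ?h = "\<Sum>a<m. p a * s a"
  let ?L = "\<lambda>a. leaves (\<lambda>v. P (a # v)) M"
  let ?d = "\<lambda>a. if P [a] then 0 else average_delay p (?L a)"
  \<comment> \<open>Stated for every \<open>s\<close>, as it is used both for the given one and for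
    the constant 1, which gives the recursion of the mean delay.\<close>
  have expand: "(\<Sum>A\<in>leaves P (Suc M). word_prob p A * (\<Sum>a\<leftarrow>A. s a)) =
      (\<Sum>a<m. p a * s a) +
      (\<Sum>a<m. p a * (if P [a] then 0 else \<Sum>u\<in>?L a. word_prob p u * (\<Sum>a\<leftarrow>u. s a)))" for s :: "nat \<Rightarrow> real"
  proof -
    have "(\<Sum>u\<in>?L a. word_prob p (a # u) * (\<Sum>a\<leftarrow>a # u. s a)) =
        p a * s a + p a * (\<Sum>u\<in>?L a. word_prob p u * (\<Sum>a\<leftarrow>u. s a))" for a
    proof -
      have "(\<Sum>u\<in>?L a. word_prob p (a # u) * (\<Sum>a\<leftarrow>a # u. s a)) =
        p a * s a * (\<Sum>u\<in>?L a. word_prob p u) + p a * (\<Sum>u\<in>?L a. word_prob p u * (\<Sum>a\<leftarrow>u. s a))"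
        by (simp add: algebra_simps sum.distrib sum_distrib_left)
      then show ?thesis by (simp add: sum_leaves_prob)
    qed
    then show ?thesis
      unfolding sum_leaves_Suc sum.distrib[symmetric]
      by (intro sum.cong) auto
  qed
  have delay: "average_delay p D = (\<Sum>A\<in>D. word_prob p A * (\<Sum>a\<leftarrow>A. 1))" for D
    by (simp add: average_delay_def sum_list_triv)
  have "average_delay p (leaves P (Suc M)) = 1 + (\<Sum>a<m. p a * ?d a)"
    unfolding delay expand by (simp add: p_sum)
  moreover have "(\<Sum>a<m. p a * (if P [a] then 0 else ?h * average_delay p (?L a))) =
      ?h * (\<Sum>a<m. p a * ?d a)"
    unfolding sum_distrib_left by (rule sum.cong) auto
  ultimately show ?case
    unfolding expand Suc by (simp add: distrib_left)
qed

text \<open>The tail-sum formula for a stopping time: the term for \<open>j\<close> is the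
  probability that \<open>P\<close> has not yet occurred within the first \<open>j\<close>
  symbols.\<close>

lemma average_delay_leaves:
  "average_delay p (leaves P M) = (\<Sum>j<M. mean j (\<lambda>u. of_bool (avoids P u)))"
proof (induction M arbitrary: P)
  case 0
  then show ?case by (simp add: average_delay_def)
next
  case (Suc M)
  let ?L = "\<lambda>a. leaves (\<lambda>v. P (a # v)) M"
  have step: "(\<Sum>u\<in>?L a. word_prob p (a # u) * real (length (a # u))) =
      p a + p a * (\<Sum>j<M. mean j (\<lambda>u. of_bool (avoids (\<lambda>v. P (a # v)) u)))" for a
  proof -
    have "(\<Sum>u\<in>?L a. word_prob p (a # u) * real (length (a # u))) =
        p a * (\<Sum>u\<in>?L a. word_prob p u) + p a * average_delay p (?L a)"
      by (simp add: average_delay_def algebra_simps sum.distrib sum_distrib_left)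
    then show ?thesis by (simp add: sum_leaves_prob Suc)
  qed
  have "average_delay p (leaves P (Suc M)) =
      (\<Sum>a<m. p a + p a * (\<Sum>j<M. if P [a] then 0 else mean j (\<lambda>u. of_bool (avoids (\<lambda>v. P (a # v)) u))))"
    unfolding average_delay_def sum_leaves_Suc step by (intro sum.cong) auto
  also have "\<dots> = 1 + (\<Sum>a<m. \<Sum>j<M. p a * mean j (\<lambda>u. of_bool (avoids P (a # u))))"
    unfolding sum.distrib p_sum sum_distrib_left
    by (intro arg_cong2[of _ _ _ _ "(+)"] sum.cong) (simp_all add: mean_const)
  also have "\<dots> = (\<Sum>j<Suc M. mean j (\<lambda>u. of_bool (avoids P u)))"
    by (subst sum.lessThan_Suc_shift, subst sum.swap) simp
  finally show ?case .
qed

text \<open>Markov's inequality for the delay: a leaf violating \<open>P\<close> was cut off, so its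
  length is exactly \<open>M\<close>.\<close>

lemma sum_leaves_not_stopped:
  "(\<Sum>A\<in>{A\<in>leaves P M. \<not> P A}. word_prob p A) * real M \<le> average_delay p (leaves P M)"
proof -
  have "(\<Sum>A\<in>{A\<in>leaves P M. \<not> P A}. word_prob p A) * real M =
      (\<Sum>A\<in>{A\<in>leaves P M. \<not> P A}. word_prob p A * real (length A))"
    unfolding sum_distrib_right by (rule sum.cong) (use leaves_stop in auto)
  also have "\<dots> \<le> average_delay p (leaves P M)"
    unfolding average_delay_def
  proof (rule sum_mono2[OF finite_leaves])
    fix A assume "A \<in> leaves P M - {A \<in> leaves P M. \<not> P A}"
    then have "word_prob p A > 0" using leaves_lists word_prob_pos by blast
    then show "0 \<le> word_prob p A * real (length A)" by simp
  qed auto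
  finally show ?thesis .
qed

section \<open>Return times of colours\<close>

text \<open>If two starts t < t' on the trajectory \<open>z\<close> had the same colour, then t'
  would be a return for t. The starts that have not returned by the end of \<open>z\<close>
  therefore have distinct colours.\<close>

lemma sum_avoids_le:
  assumes "finite C" "\<And>w. w \<in> lists {..<m} \<Longrightarrow> col w \<in> C" "z \<in> lists {..<m}"
  shows "(\<Sum>t\<le>length z. of_bool (avoids (\<lambda>v. col (take t z @ v) = col (take t z)) (drop t z))) \<le> real (card C)"
proof -
  define Q where "Q t \<longleftrightarrow> avoids (\<lambda>v. col (take t z @ v) = col (take t z)) (drop t z)" for t
  let ?T = "{..length z} \<inter> {t. Q t}"
  have neq: "col (take t z) \<noteq> col (take t' z)" if "t \<in> ?T" "t' \<in> ?T" "t < t'" for t t'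
  proof -
    let ?v = "take (t' - t) (drop t z)"
    have v: "prefix ?v (drop t z)" "?v \<noteq> []" using that by (auto simp: take_is_prefix)
    have "take t z @ ?v = take t' z"
      using take_add[of t "t' - t" z] that(3) by simp
    moreover have "avoids (\<lambda>v. col (take t z @ v) = col (take t z)) (drop t z)"
      using that(1) by (simp add: Q_def)
    note avoids_prefix[OF this v]
    ultimately show ?thesis by metis
  qed
  have "inj_on (\<lambda>t. col (take t z)) ?T"
  proof (rule inj_onI)
    fix t t' assume "t \<in> ?T" "t' \<in> ?T" "col (take t z) = col (take t' z)"
    then show "t = t'" using neq[of t t'] neq[of t' t] by (cases t t' rule: linorder_cases) auto
  qed
  moreover have "(\<lambda>t. col (take t z)) ` ?T \<subseteq> C"
  proof
    fix c assume "c \<in> (\<lambda>t. col (take t z)) ` ?T"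
    then obtain t where "c = col (take t z)" by auto
    moreover have "take t z \<in> lists {..<m}" using assms(3) by (auto dest: in_set_takeD)
    ultimately show "c \<in> C" using assms(2) by simp
  qed
  ultimately have "card ?T \<le> card C" using assms(1) by (rule card_inj_on_le)
  moreover have "(\<Sum>t\<le>length z. of_bool (Q t)) = real (card ?T)"
    by (simp only: sum_of_bool_eq finite_atMost)
  ultimately have "(\<Sum>t\<le>length z. of_bool (Q t)) \<le> real (card C)" by simp
  then show ?thesis unfolding Q_def .
qed

text \<open>A finite form of Kac's return time lemma: at time s of any trajectory, at most one start
  per colour has not yet returned to its colour, so the mean return time averaged over the
  starts is at most the number of colours.\<close>

lemma exists_short_return:
  assumes C: "finite C" "\<And>w. w \<in> lists {..<m} \<Longrightarrow> col w \<in> C" and "M > 0"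
  shows "\<exists>w\<in>lists {..<m}. average_delay p (leaves (\<lambda>v. col (w @ v) = col w) M) \<le> 2 * real (card C)"
proof (rule ccontr)
  assume neg: "\<not> ?thesis"
  define d where "d w = average_delay p (leaves (\<lambda>v. col (w @ v) = col w) M)" for w
  define g :: "nat \<Rightarrow> nat list \<Rightarrow> real" where
    "g t z = of_bool (avoids (\<lambda>v. col (take t z @ v) = col (take t z)) (drop t z))" for t z
  have g_nonneg: "0 \<le> mean s (g t)" for s t
    using mean_mono[of s "\<lambda>_. 0" "g t"] by (simp add: mean_const g_def)
  have mean_d: "mean t d = (\<Sum>j<M. mean (t + j) (g t))" for t
  proof -
    have "mean t d = (\<Sum>j<M. mean t (\<lambda>w. mean j (\<lambda>u. of_bool (avoids (\<lambda>v. col (w @ v) = col w) u))))"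
      unfolding d_def average_delay_leaves by (rule mean_sum)
    also have "\<dots> = (\<Sum>j<M. mean t (\<lambda>w. mean j (\<lambda>u. g t (w @ u))))"
      by (intro sum.cong refl mean_cong) (simp add: g_def)
    finally show ?thesis by (simp add: mean_append)
  qed
  have "2 * real (card C) < mean t d" for t
    by (rule mean_greater) (use neg in \<open>auto simp: d_def not_le\<close>)
  then have "(\<Sum>t<M. 2 * real (card C)) < (\<Sum>t<M. mean t d)"
    using \<open>M > 0\<close> by (intro sum_strict_mono) auto
  \<comment> \<open>Reindexed by the absolute time s = t + j. The starts t < \<open>M\<close> only
    involve times s < 2\<open>M\<close>, and each time contributes at most \<open>card C\<close>;
    this ratio of times to starts is the factor 2 in the bound.\<close>
  also have "\<dots> \<le> (\<Sum>t<M. \<Sum>s<2*M. if t \<le> s then mean s (g t) else 0)"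
  proof (rule sum_mono)
    fix t assume "t \<in> {..<M}"
    have "mean t d = (\<Sum>s\<in>{t..<t+M}. mean s (g t))"
      unfolding mean_d
      by (rule sum.reindex_bij_witness[of _ "\<lambda>s. s - t" "\<lambda>j. t + j"]) auto
    also have "\<dots> = (\<Sum>s\<in>{t..<t+M}. if t \<le> s then mean s (g t) else 0)" by simp
    also have "\<dots> \<le> (\<Sum>s<2*M. if t \<le> s then mean s (g t) else 0)"
      by (rule sum_mono2) (use \<open>t \<in> {..<M}\<close> g_nonneg in auto)
    finally show "mean t d \<le> (\<Sum>s<2*M. if t \<le> s then mean s (g t) else 0)" .
  qed
  also have "\<dots> = (\<Sum>s<2*M. \<Sum>t<M. if t \<le> s then mean s (g t) else 0)"
    by (rule sum.swap)
  also have "\<dots> \<le> (\<Sum>s<2*M. real (card C))"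
  proof (rule sum_mono)
    fix s
    have "(\<Sum>t<M. if t \<le> s then mean s (g t) else 0) = (\<Sum>t\<in>{..<M} \<inter> {t. t \<le> s}. mean s (g t))"
      by (simp add: sum.If_cases)
    also have "\<dots> \<le> (\<Sum>t\<le>s. mean s (g t))"
      by (rule sum_mono2) (use g_nonneg in auto)
    also have "\<dots> = mean s (\<lambda>z. \<Sum>t\<le>s. g t z)"
      by (rule mean_sum[symmetric])
    also have "\<dots> \<le> mean s (\<lambda>_. real (card C))"
    proof (rule mean_mono)
      fix z :: "nat list" assume "z \<in> lists {..<m}" "length z = s"
      then show "(\<Sum>t\<le>s. g t z) \<le> real (card C)"
        using sum_avoids_le[of C col z, OF C] unfolding g_def by simp
    qed
    finally show "(\<Sum>t<M. if t \<le> s then mean s (g t) else 0) \<le> real (card C)"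
      by (simp add: mean_const)
  qed
  finally show False by simp
qed

section \<open>Bounds for word probabilities and their logarithms\<close>

definition max_prob :: real where "max_prob = Max (p ` {..<m})"

lemma p_le_max_prob: "i < m \<Longrightarrow> p i \<le> max_prob"
  by (simp add: max_prob_def)

text \<open>As there are at least two symbols, all of positive probability, none has probability
  1.\<close>

lemma max_prob_bounds: "0 < max_prob" "max_prob < 1"
proof -
  have "max_prob \<in> p ` {..<m}"
    unfolding max_prob_def using m_ge_2 by (intro Max_in) (auto simp: lessThan_empty_iff)
  then obtain i where i: "i < m" "max_prob = p i" by auto
  then show "0 < max_prob" using p_pos by simp
  have "{..<m} - {i} \<noteq> {}"
  proof
    assume "{..<m} - {i} = {}"
    then have "card {..<m} \<le> card {i}" by (intro card_mono) auto
    then show False using m_ge_2 by simp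
  qed
  then have "0 < (\<Sum>j\<in>{..<m} - {i}. p j)"
    by (intro sum_pos) (auto simp: p_pos)
  then show "max_prob < 1" using p_sum sum.remove[of "{..<m}" i p] i by simp
qed

lemma word_prob_le: "u \<in> lists {..<m} \<Longrightarrow> word_prob p u \<le> max_prob ^ length u"
proof (induction u)
  case (Cons a u)
  then have "p a * word_prob p u \<le> max_prob * max_prob ^ length u"
    using p_le_max_prob[of a] p_pos[of a] word_prob_pos[of u] by (intro mult_mono) auto
  then show ?case by simp
qed simp

text \<open>Puts the self-information of a word into the additive form to which
  \<open>wald_identity\<close> applies.\<close>

lemma log_word_prob:
  assumes "n \<ge> 2" "u \<in> lists {..<m}"
  shows "- log (real n) (word_prob p u) = (\<Sum>a\<leftarrow>u. - log (real n) (p a))"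
  using assms(2)
proof (induction u)
  case (Cons a u)
  then have "word_prob p u > 0" "p a > 0" using word_prob_pos p_pos by auto
  with Cons show ?case using assms(1) by (simp add: log_mult)
qed simp

lemma entropy_eq:
  assumes "n \<ge> 2"
  shows "entropy m p / log 2 (real n) = (\<Sum>a<m. p a * - log (real n) (p a))"
proof -
  have "log (real n) x = log 2 x / log 2 (real n)" for x
    using assms by (simp add: log_def)
  then show ?thesis
    by (simp add: entropy_def sum_negf sum_divide_distrib)
qed

section \<open>The code for given k and q\<close>

text \<open>The mean excess over the self-information has three sources: 1/q from rounding, 1/q from
  words cut off before their return, and 2 ln n / q + \<open>max_prob ^ k\<close> from lengthened
  code words. The lower bound on \<open>q\<close> ensures that the dictionary has enough probability
  to lengthen.\<close>

lemma exists_code: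
  fixes n k q :: nat
  assumes n: "n \<ge> 2" and k: "k \<ge> 1" and q: "q \<ge> 1" "real q \<ge> 2 * ln (real n)"
  shows "\<exists>D \<phi>. word_based_code m n D \<phi> \<and> decipherable D \<phi> \<and>
    real k \<le> average_delay p D \<and> average_delay p D \<le> 2 * real (q * k) \<and>
    (\<Sum>A\<in>D. word_prob p A * real (length (\<phi> A))) \<le>
      entropy m p / log 2 (real n) * average_delay p D
        + (2 + 2 * ln (real n)) / real q + max_prob ^ k"
proof -
  define S where "S u = - log (real n) (word_prob p u)" for u
  have S_append: "S (w @ u) = S w + S u" if "w \<in> lists {..<m}" "u \<in> lists {..<m}" for w u
  proof -
    have "word_prob p (w @ u) = word_prob p w * word_prob p u" by (simp add: word_prob_def)
    then show ?thesis using word_prob_pos[OF that(1)] word_prob_pos[OF that(2)] n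
      by (simp add: S_def log_mult)
  qed
  define col where "col w = (nat \<lfloor>real q * frac (S w)\<rfloor>, length w mod k)" for w :: "nat list"
  define C where "C = {..<q} \<times> {..<k}"
  have C: "finite C" "card C = q * k" by (simp_all add: C_def)
  have fl: "0 \<le> \<lfloor>real q * frac x\<rfloor>" "\<lfloor>real q * frac x\<rfloor> < int q" for x
  proof -
    have "real q * frac x < real q * 1" using q frac_lt_1 by (intro mult_strict_left_mono) auto
    then show "\<lfloor>real q * frac x\<rfloor> < int q" by (simp add: floor_less_iff)
  qed (simp add: frac_ge_0)
  have col: "col w \<in> C" for w
    using fl[of "S w"] k by (auto simp: col_def C_def nat_less_iff)
  \<comment> \<open>The mean delay will be at most 2qk, so by Markov's inequality a word is cut off
    at this length with probability at most 2qk / \<open>M\<close> = 1/q.\<close>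
  define M where "M = 2 * q * q * k"
  have M: "M > 0" "M \<ge> k" using q k by (simp_all add: M_def)
  obtain w where w: "w \<in> lists {..<m}"
    and short: "average_delay p (leaves (\<lambda>v. col (w @ v) = col w) M) \<le> 2 * real (q * k)"
    using exists_short_return[of C col M, OF C(1) col M(1)] unfolding C(2) by (rule bexE)
  define P where "P = (\<lambda>v. col (w @ v) = col w)"
  define D where "D = leaves P M"
  let ?N = "average_delay p D"
  have N_le: "?N \<le> 2 * real (q * k)" using short by (simp add: D_def P_def)
  have D: "finite D" "D \<subseteq> lists {..<m}" "[] \<notin> D" "prefix_free D"
    unfolding D_def using M(1) by (simp_all add: finite_leaves leaves_lists Nil_notin_leaves prefix_free_leaves)
  have pos: "word_prob p A > 0" if "A \<in> D" for A using that D(2) word_prob_pos by blast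
  have total: "(\<Sum>A\<in>D. word_prob p A) = 1" unfolding D_def by (rule sum_leaves_prob)
  \<comment> \<open>A return adds a positive multiple of \<open>k\<close> to the length of
    \<open>w\<close>; a word that is cut off has length \<open>M\<close>, which is at least
    \<open>k\<close>.\<close>
  have length_ge: "length A \<ge> k" if "A \<in> D" for A
  proof (cases "P A")
    case True
    then have "(length w + length A) mod k = length w mod k" by (simp add: P_def col_def)
    then have "k dvd length A"
      by (metis add_diff_cancel_left' le_add1 mod_eq_dvd_iff_nat)
    moreover have "length A > 0" using that D(3) by auto
    ultimately show ?thesis by (rule dvd_imp_le)
  next
    case False
    then show ?thesis using leaves_stop[of A P M] that M(2) by (simp add: D_def)
  qed
  have prob_le: "word_prob p A \<le> max_prob ^ k" if "A \<in> D" for A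
  proof -
    have "word_prob p A \<le> max_prob ^ length A" using word_prob_le that D(2) by blast
    also have "\<dots> \<le> max_prob ^ k"
      using length_ge[OF that] max_prob_bounds by (intro power_decreasing) auto
    finally show ?thesis .
  qed
  have "max_prob ^ k < 1"
    using max_prob_bounds k power_strict_decreasing[of 0 k max_prob] by simp
  have "real k = (\<Sum>A\<in>D. word_prob p A * real k)"
    by (simp add: total flip: sum_distrib_right)
  also have "\<dots> \<le> ?N"
    unfolding average_delay_def
    by (intro sum_mono mult_left_mono) (use length_ge pos in \<open>auto intro: less_imp_le\<close>)
  finally have k_le: "real k \<le> ?N" .
  have S_nonneg: "S A \<ge> 0" if "A \<in> D" for A
  proof -
    have "word_prob p A \<le> 1" using prob_le[OF that] \<open>max_prob ^ k < 1\<close> by simp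
    then show ?thesis using pos[OF that] n by (simp add: S_def)
  qed
  have entropy_sum: "(\<Sum>A\<in>D. word_prob p A * S A) = entropy m p / log 2 (real n) * ?N"
  proof -
    have "(\<Sum>A\<in>D. word_prob p A * S A) = (\<Sum>A\<in>D. word_prob p A * (\<Sum>a\<leftarrow>A. - log (real n) (p a)))"
    proof (rule sum.cong[OF refl])
      fix A assume "A \<in> D"
      then have "A \<in> lists {..<m}" using D(2) by blast
      then show "word_prob p A * S A = word_prob p A * (\<Sum>a\<leftarrow>A. - log (real n) (p a))"
        by (simp only: S_def log_word_prob[OF n])
    qed
    then show ?thesis unfolding D_def entropy_eq[OF n] by (simp only: wald_identity)
  qed
  define bad where "bad = {A \<in> D. \<not> P A}"
  have bad: "(\<Sum>A\<in>bad. word_prob p A) \<le> 1 / real q"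
  proof -
    have "(\<Sum>A\<in>bad. word_prob p A) * real M \<le> 2 * real (q * k)"
      using sum_leaves_not_stopped[of P M] N_le unfolding bad_def D_def by linarith
    then have "((\<Sum>A\<in>bad. word_prob p A) * real q) * (2 * real (q * k)) \<le> 1 * (2 * real (q * k))"
      by (simp add: M_def algebra_simps)
    then have "(\<Sum>A\<in>bad. word_prob p A) * real q \<le> 1"
      using q(1) k by (subst (asm) mult_le_cancel_right) auto
    then show ?thesis using q(1) by (simp add: field_simps)
  qed
  \<comment> \<open>Since n \<ge> 2, one more letter at least halves a Kraft term. Lengthening on a
    set of probability at least 2 ln n / q thus gains a factor of at most 1 - ln n / q \<le> exp (-
    ln n / q), which cancels the n^(1/q) lost in rounding.\<close>
  have T: "0 \<le> 2 * ln (real n) / real q" "2 * ln (real n) / real q \<le> (\<Sum>A\<in>D. word_prob p A)"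
    using n q by (simp_all add: total field_simps)
  obtain B where B: "B \<subseteq> D" "2 * ln (real n) / real q \<le> (\<Sum>A\<in>B. word_prob p A)"
    "(\<Sum>A\<in>B. word_prob p A) \<le> 2 * ln (real n) / real q + max_prob ^ k"
    using exists_subset_sum_between[of D "word_prob p" "max_prob ^ k" "2 * ln (real n) / real q", OF D(1) prob_le T]
      max_prob_bounds by auto
  \<comment> \<open>With 1/q subtracted before rounding up, a value less than 1/q above an integer r
    is still rounded to at most r. Truncation at 0 preserves the upper bound because
    \<open>S A\<close> is nonnegative.\<close>
  define l0 where "l0 A = nat \<lceil>S A - 1 / real q\<rceil>" for A
  define l where "l A = l0 A + of_bool (A \<in> B)" for A
  have l0_ge: "real (l0 A) \<ge> S A - 1 / real q" for A
    unfolding l0_def by linarith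
  have l0_le: "real (l0 A) \<le> S A + 1 / real q + of_bool (A \<in> bad)" if A: "A \<in> D" for A
  proof (cases "A \<in> bad")
    case True
    have "1 / real q \<ge> 0" by simp
    moreover have "real (l0 A) \<le> max 0 (S A - 1 / real q + 1)" unfolding l0_def by linarith
    ultimately have "real (l0 A) \<le> S A + 1 / real q + 1" using S_nonneg[OF A] by linarith
    then show ?thesis using True by simp
  next
    case False
    then have "col (w @ A) = col w" using A by (simp add: bad_def P_def)
    then have "\<lfloor>real q * frac (S (w @ A))\<rfloor> = \<lfloor>real q * frac (S w)\<rfloor>"
      using fl(1) by (simp add: col_def eq_nat_nat_iff)
    from near_integer[OF this] obtain r :: int
      where "\<bar>S (w @ A) - S w - of_int r\<bar> < 1 / real q" using q(1) by auto
    \<comment> \<open>By additivity \<open>S A\<close> is the difference of two values in the same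
      cell modulo 1, hence close to an integer.\<close>
    moreover have "S (w @ A) = S w + S A" using S_append[OF w] A D(2) by blast
    ultimately have r: "\<bar>S A - of_int r\<bar> < 1 / real q" by simp
    then have "\<lceil>S A - 1 / real q\<rceil> \<le> r" by (simp add: ceiling_le_iff)
    then have "real (l0 A) \<le> max 0 (of_int r)" unfolding l0_def by linarith
    moreover have "of_int r \<le> S A + 1 / real q" using r by linarith
    moreover have "0 \<le> S A + 1 / real q" using S_nonneg[OF A] by simp
    ultimately show ?thesis using False by simp
  qed
  have kraft: "(\<Sum>A\<in>D. 1 / real n ^ l A) \<le> 1"
  proof -
    have "(\<Sum>A\<in>D. 1 / real n ^ l A) \<le>
      (\<Sum>A\<in>D. exp (ln (real n) / real q) * (word_prob p A - of_bool (A \<in> B) * (word_prob p A / 2)))"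
    proof (rule sum_mono)
      fix A assume A: "A \<in> D"
      have "1 / real n ^ l0 A = real n powr (- real (l0 A))"
        using n by (simp add: powr_minus powr_realpow divide_inverse)
      also have "\<dots> \<le> real n powr (1 / real q - S A)"
        using n l0_ge[of A] by (intro powr_mono) auto
      also have "\<dots> = real n powr (1 / real q) * real n powr log (real n) (word_prob p A)"
        by (simp add: S_def flip: powr_add)
      also have "\<dots> = exp (ln (real n) / real q) * word_prob p A"
        using n pos[OF A] by (simp add: powr_def[of _ "1 / _"])
      finally have l0: "1 / real n ^ l0 A \<le> exp (ln (real n) / real q) * word_prob p A" .
      show "1 / real n ^ l A \<le>
        exp (ln (real n) / real q) * (word_prob p A - of_bool (A \<in> B) * (word_prob p A / 2))"
      proof (cases "A \<in> B")
        case True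
        have "1 / real n ^ l A = 1 / real n ^ l0 A * (1 / real n)"
          using True by (simp add: l_def)
        also have "\<dots> \<le> (exp (ln (real n) / real q) * word_prob p A) * (1 / 2)"
          using l0 n pos[OF A] by (intro mult_mono) auto
        finally show ?thesis using True by (simp add: field_simps)
      qed (use l0 in \<open>simp add: l_def\<close>)
    qed
    also have "\<dots> = exp (ln (real n) / real q) * (1 - (\<Sum>A\<in>B. word_prob p A) / 2)"
    proof -
      have "(\<Sum>A\<in>D. of_bool (A \<in> B) * (word_prob p A / 2)) = (\<Sum>A\<in>B. word_prob p A / 2)"
        using B(1) D(1) by (intro sum.mono_neutral_cong_right) auto
      then show ?thesis
        by (simp add: sum_subtractf total sum_divide_distrib flip: sum_distrib_left)
    qed
    also have "\<dots> \<le> exp (ln (real n) / real q) * exp (- (ln (real n) / real q))"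
    proof (rule mult_left_mono)
      have "1 - (\<Sum>A\<in>B. word_prob p A) / 2 \<le> 1 + - (ln (real n) / real q)"
        using B(2) by (simp add: mult.commute)
      also have "\<dots> \<le> exp (- (ln (real n) / real q))" by (rule exp_ge_add_one_self)
      finally show "1 - (\<Sum>A\<in>B. word_prob p A) / 2 \<le> exp (- (ln (real n) / real q))" .
    qed simp
    also have "\<dots> = 1" by (simp add: exp_minus)
    finally show ?thesis .
  qed
  obtain \<phi> where \<phi>: "\<phi> ` D \<subseteq> lists {..<n}" "\<And>A. A \<in> D \<Longrightarrow> length (\<phi> A) = l A"
    "inj_on \<phi> D" "prefix_free (\<phi> ` D)"
    using kraft_converse[OF D(1) _ kraft] n by (metis not_numeral_le_zero zero_less_iff_neq_zero)
  \<comment> \<open>An empty code word is a prefix of all others, so the dictionary would be a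
    single word of probability 1, against the bound \<open>max_prob ^ k\<close> < 1.\<close>
  have nonempty: "[] \<notin> \<phi> ` D"
  proof
    assume "[] \<in> \<phi> ` D"
    then obtain A where A: "A \<in> D" "\<phi> A = []" by force
    have "B' = A" if "B' \<in> D" for B'
    proof -
      have "\<phi> A = \<phi> B'"
        using prefix_freeD[OF \<phi>(4) imageI[OF A(1)] imageI[OF that]] A(2) by simp
      then show ?thesis using inj_onD[OF \<phi>(3) _ A(1) that] by simp
    qed
    then have "D = {A}" using A(1) by blast
    then show False using total prob_le[OF A(1)] \<open>max_prob ^ k < 1\<close> by simp
  qed
  have cover: "\<exists>A\<in>D. \<exists>y\<in>streams {..<m}. x = A @- y" if "x \<in> streams {..<m}" for x
    unfolding D_def using that by (rule leaves_cover)
  have "word_based_code m n D \<phi>"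
    unfolding word_based_code_def
  proof (intro conjI ballI)
    fix x :: "nat stream" assume "x \<in> streams {..<m}"
    then show "\<exists>!ws. ws \<in> streams D \<and> flat ws = x"
      by (intro ex1_parse[of D "{..<m}", OF D(4,3)] cover)
  qed (use D \<phi> in auto)
  moreover have "decipherable D \<phi>" using \<phi>(3,4) nonempty by (rule decipherableI)
  moreover have "(\<Sum>A\<in>D. word_prob p A * real (length (\<phi> A))) \<le>
      entropy m p / log 2 (real n) * ?N + (2 + 2 * ln (real n)) / real q + max_prob ^ k"
  proof -
    have "(\<Sum>A\<in>D. word_prob p A * real (length (\<phi> A))) \<le>
      (\<Sum>A\<in>D. word_prob p A * (S A + 1 / real q + of_bool (A \<in> bad) + of_bool (A \<in> B)))"
      using l0_le pos
      by (intro sum_mono mult_left_mono) (auto simp: \<phi>(2) l_def intro: less_imp_le)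
    also have "\<dots> = (\<Sum>A\<in>D. word_prob p A * S A) + 1 / real q
        + (\<Sum>A\<in>bad. word_prob p A) + (\<Sum>A\<in>B. word_prob p A)"
    proof -
      have "(\<Sum>A\<in>D. word_prob p A * of_bool (A \<in> X)) = (\<Sum>A\<in>X. word_prob p A)" if "X \<subseteq> D" for X
        using that D(1) by (intro sum.mono_neutral_cong_right) auto
      moreover have "bad \<subseteq> D" by (auto simp: bad_def)
      ultimately show ?thesis
        using B(1) by (simp add: distrib_left sum.distrib total flip: sum_divide_distrib)
    qed
    also have "\<dots> \<le> entropy m p / log 2 (real n) * ?N + 1 / real q + 1 / real q
        + (2 * ln (real n) / real q + max_prob ^ k)"
      unfolding entropy_sum using bad B(3) by linarith
    finally show ?thesis by (simp add: add_divide_distrib)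
  qed
  ultimately show ?thesis using k_le N_le by (intro exI[of _ D] exI[of _ \<phi>] conjI)
qed

end

section \<open>Choice of the parameters\<close>

theorem corollary2:
  fixes m n :: nat and p :: "nat \<Rightarrow> real"
  assumes "m \<ge> 2" and "n \<ge> 2"
    and "\<And>i. i < m \<Longrightarrow> p i > 0"
    and "(\<Sum>i<m. p i) = 1"
  shows "\<exists>c>0. \<exists>(D :: nat \<Rightarrow> nat list set) (\<phi> :: nat \<Rightarrow> nat list \<Rightarrow> nat list).
    (\<forall>k. word_based_code m n (D k) (\<phi> k) \<and> decipherable (D k) (\<phi> k)) \<and>
    filterlim (\<lambda>k. average_delay p (D k)) at_top sequentially \<and>
    (\<forall>k. redundancy m n p (D k) (\<phi> k) \<le> c * average_delay p (D k) powr (- (5 / 3)))"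
proof -
  interpret bernoulli_source m p by unfold_locales (use assms in auto)
  \<comment> \<open>To be absorbed into the error 1/k^2, the term \<open>max_prob ^ k\<close> must
    be O(1/k^2). Taking the square root reduces this to the limit of k x^k for 0 < x < 1.\<close>
  have "(\<lambda>k. real k * sqrt max_prob ^ k) \<longlonglongrightarrow> 0"
    using max_prob_bounds by (intro powser_times_n_limit_0) simp
  then have "(\<lambda>k. (real k * sqrt max_prob ^ k) ^ 2) \<longlonglongrightarrow> 0 ^ 2"
    by (rule tendsto_power)
  moreover have "(real k * sqrt max_prob ^ k) ^ 2 = real k ^ 2 * max_prob ^ k" for k
    using max_prob_bounds by (simp add: power_mult_distrib flip: real_sqrt_power)
  ultimately have "(\<lambda>k. real k ^ 2 * max_prob ^ k) \<longlonglongrightarrow> 0" by simp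
  then have "Bseq (\<lambda>k. real k ^ 2 * max_prob ^ k)"
    by (intro convergent_imp_Bseq convergentI)
  then obtain K where K: "K > 0" "\<And>k. norm (real k ^ 2 * max_prob ^ k) \<le> K"
    by (elim BseqE) blast
  \<comment> \<open>The factor 4 comes from N \<le> 2 k^3 \<le> (2k)^3, which gives N^(2/3) \<le> 4
    k^2 for the mean delay N.\<close>
  define c where "c = 4 * (2 + 2 * ln (real n) + K)"
  have ln_n: "ln (real n) \<ge> 0" using assms(2) by simp
  then have c: "c > 0" using K(1) by (simp add: c_def add_pos_pos)
  \<comment> \<open>Shifting the index by \<open>k0\<close> gives k^2 \<ge> k \<ge> 2 ln n from the
    first code on, so the bound holds for the whole sequence.\<close>
  define k0 where "k0 = Suc (nat \<lceil>2 * ln (real n)\<rceil>)"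
  have k0: "real k0 \<ge> 2 * ln (real n)" "k0 \<ge> 1" unfolding k0_def by linarith+
  have "\<exists>D \<phi>. word_based_code m n D \<phi> \<and> decipherable D \<phi> \<and> real j \<le> average_delay p D \<and>
    redundancy m n p D \<phi> \<le> c * average_delay p D powr (- (5 / 3))" for j
  proof -
    define k where "k = j + k0"
    have k: "k \<ge> 1" "real k > 0" using k0 by (simp_all add: k_def)
    have "k ^ 2 \<ge> k" by (simp add: power2_eq_square)
    then have sq: "k ^ 2 \<ge> 1" "real (k ^ 2) \<ge> 2 * ln (real n)"
      using k(1) k0(1) unfolding k_def by linarith+
    \<comment> \<open>Here q = k^2: the mean excess is O(1/k^2) while the mean delay N is at most 2
      k^3, so the excess is O(N^(-2/3)). Dividing by N produces the exponent -5/3.\<close>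
    from exists_code[OF assms(2) k(1) sq]
    obtain D \<phi> where code: "word_based_code m n D \<phi>" "decipherable D \<phi>"
      and N: "real k \<le> average_delay p D" "average_delay p D \<le> 2 * real (k ^ 2 * k)"
      and L: "(\<Sum>A\<in>D. word_prob p A * real (length (\<phi> A))) \<le>
        entropy m p / log 2 (real n) * average_delay p D
        + (2 + 2 * ln (real n)) / real (k ^ 2) + max_prob ^ k"
      by (elim exE conjE)
    let ?N = "average_delay p D"
    have N_pos: "?N > 0" using N(1) k(2) by linarith
    have "max_prob ^ k \<le> K / real (k ^ 2)"
      using K(2)[of k] k(2) max_prob_bounds by (simp add: pos_le_divide_eq mult.commute)
    then have "(\<Sum>A\<in>D. word_prob p A * real (length (\<phi> A))) \<le>
        entropy m p / log 2 (real n) * ?N + (2 + 2 * ln (real n) + K) / real (k ^ 2)"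
      using L by (simp add: add_divide_distrib)
    then have "(\<Sum>A\<in>D. word_prob p A * real (length (\<phi> A))) / ?N \<le>
        (entropy m p / log 2 (real n) * ?N + (2 + 2 * ln (real n) + K) / real (k ^ 2)) / ?N"
      using N_pos by (intro divide_right_mono) auto
    also have "\<dots> = entropy m p / log 2 (real n) + (2 + 2 * ln (real n) + K) / real (k ^ 2) / ?N"
      using N_pos by (subst add_divide_distrib) simp
    finally have "redundancy m n p D \<phi> \<le> (2 + 2 * ln (real n) + K) / real (k ^ 2) / ?N"
      unfolding redundancy_def by linarith
    also have "\<dots> \<le> c * ?N powr (- (2 / 3)) / ?N"
    proof (rule divide_right_mono)
      have "?N powr (2 / 3) \<le> ((2 * real k) powr 3) powr (2 / 3)"
      proof (rule powr_mono2)
        have "2 * real (k ^ 2 * k) \<le> (2 * real k) ^ 3"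
          by (simp add: power_mult_distrib power3_eq_cube power2_eq_square)
        with N(2) have "?N \<le> (2 * real k) ^ 3" by (rule order.trans)
        also have "\<dots> = (2 * real k) powr 3" using k(2) by (subst powr_numeral) simp_all
        finally show "?N \<le> (2 * real k) powr 3" .
      qed (use N_pos in auto)
      also have "\<dots> = (2 * real k) powr 2" by (simp only: powr_powr) simp
      also have "\<dots> = 4 * real (k ^ 2)"
        using k(2) by (subst powr_numeral) (simp_all add: power_mult_distrib)
      finally have N_powr: "?N powr (2 / 3) \<le> 4 * real (k ^ 2)" .
      have "4 / (4 * real (k ^ 2)) \<le> 4 / ?N powr (2 / 3)"
        by (rule frac_le[OF _ order.refl _ N_powr]) (use N_pos in simp_all)
      moreover have "4 / ?N powr (2 / 3) = 4 * ?N powr (- (2 / 3))"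
        by (simp only: powr_minus divide_inverse)
      ultimately have "1 / real (k ^ 2) \<le> 4 * ?N powr (- (2 / 3))"
        by simp
      then have "(2 + 2 * ln (real n) + K) * (1 / real (k ^ 2)) \<le>
          (2 + 2 * ln (real n) + K) * (4 * ?N powr (- (2 / 3)))"
        by (rule mult_left_mono) (use ln_n K(1) in simp)
      also have "\<dots> = c * ?N powr (- (2 / 3))"
        unfolding c_def by (rule mult.assoc[symmetric, THEN trans]) (simp only: mult.commute)
      finally show "(2 + 2 * ln (real n) + K) / real (k ^ 2) \<le> c * ?N powr (- (2 / 3))"
        by simp
    qed (use N_pos in simp)
    also have "\<dots> = c * ?N powr (- (5 / 3))"
    proof -
      have "?N powr (- (5 / 3)) = ?N powr (- (2 / 3) - 1)" by simp
      also have "\<dots> = ?N powr (- (2 / 3)) / ?N" using N_pos by (simp only: powr_diff powr_one)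
      finally show ?thesis by simp
    qed
    finally show ?thesis using code N(1) unfolding k_def by (intro exI[of _ D] exI[of _ \<phi>]) simp
  qed
  then obtain D \<phi> where D: "\<And>j. word_based_code m n (D j) (\<phi> j)" "\<And>j. decipherable (D j) (\<phi> j)"
    "\<And>j. real j \<le> average_delay p (D j)"
    "\<And>j. redundancy m n p (D j) (\<phi> j) \<le> c * average_delay p (D j) powr (- (5 / 3))"
    by metis
  have "filterlim (\<lambda>j. average_delay p (D j)) at_top sequentially"
    by (rule filterlim_at_top_mono[OF filterlim_real_sequentially]) (simp add: D(3))
  then show ?thesis
    using c D by (intro exI[of _ c] exI[of _ D] exI[of _ \<phi>] conjI allI) blast+
qed

end
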